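(* The ordinary generating function, with respect to length, of partial GDAP ending at a point with positive ordinate is $$\frac{\left(x^2-x-1+\sqrt{x^4-2x^3-x^2-2x+1}\right)^2}{4x\sqrt{x^4-2x^3-x^2-2x+1}},$$ where the square root is the formal power series with constant term $1$.
   Context: A grand Dyck path with air pockets (GDAP) is a lattice path in $\mathbb{Z}^2$ starting at $(0,0)$ and ending on the $x$-axis, consisting of up-steps $U=(1,1)$ and down-steps $D_k=(1,-k)$ with $k\ge 1$, such that no two down-steps are consecutive; the path may go below the $x$-axis, and the empty path is a GDAP. A partial GDAP is a prefix (initial segment, possibly the whole path) of a GDAP. The length of a path is its number of steps. *)

theory Defs
  imports
    Complex_Main
    "HOL-Library.Product_Plus"
    "HOL-Library.Sublist"
    "HOL-Computational_Algebra.Formal_Power_Series"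
    "HOL-Computational_Algebra.Formal_Laurent_Series"
begin

definition up_step :: "int \<times> int" where
  "up_step = (1, 1)"

definition down_step :: "nat \<Rightarrow> int \<times> int" where
  "down_step k = (1, - int k)"

definition down_steps :: "(int \<times> int) set" where
  "down_steps = {down_step k |k. k \<ge> 1}"

(* A path is the list of its step vectors; it starts at the origin and its length is the
   length of the list. *)
definition endpoint :: "(int \<times> int) list \<Rightarrow> int \<times> int" where
  "endpoint p = sum_list p"

definition gdap :: "(int \<times> int) list \<Rightarrow> bool" where
  "gdap p \<longleftrightarrow>
     set p \<subseteq> insert up_step down_steps \<and>
     (\<forall>i. Suc i < length p \<longrightarrow> \<not> (p ! i \<in> down_steps \<and> p ! Suc i \<in> down_steps)) \<and>
     snd (endpoint p) = 0"

definition partial_gdap :: "(int \<times> int) list \<Rightarrow> bool" where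
  "partial_gdap p \<longleftrightarrow> (\<exists>q. gdap q \<and> prefix p q)"

definition positive_partial_gdaps :: "nat \<Rightarrow> (int \<times> int) list set" where
  "positive_partial_gdaps n = {p. partial_gdap p \<and> length p = n \<and> snd (endpoint p) > 0}"

(* There are infinitely many steps, but a path of length n that ends above the x-axis can only
   use the down-steps of size less than n, so the cardinalities below are genuine. *)
lemma finite_positive_partial_gdaps: "finite (positive_partial_gdaps n)"
proof -
  have height: "snd (sum_list p) \<le> int (length p)"
    if "set p \<subseteq> insert up_step down_steps" for p
    using that by (induction p) (auto simp: up_step_def down_steps_def down_step_def)
  have bound: "- int n \<le> snd v"
    if p: "p \<in> positive_partial_gdaps n" and v: "v \<in> set p" for p v
  proof -
    from p have sub: "set p \<subseteq> insert up_step down_steps"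
      by (auto simp: positive_partial_gdaps_def partial_gdap_def gdap_def dest: set_mono_prefix)
    from v obtain xs ys where xs: "p = xs @ v # ys" by (auto dest: split_list)
    have "snd (sum_list xs) \<le> int (length xs)" "snd (sum_list ys) \<le> int (length ys)"
      using sub xs by (auto intro!: height)
    moreover have "snd (sum_list xs) + (snd v + snd (sum_list ys)) > 0" "length p = n"
      using p xs by (auto simp: positive_partial_gdaps_def endpoint_def)
    ultimately show ?thesis using xs by auto
  qed
  have "positive_partial_gdaps n \<subseteq>
    {p. set p \<subseteq> {1} \<times> {- int n..1} \<and> length p = n}"
  proof
    fix p assume p: "p \<in> positive_partial_gdaps n"
    then have "set p \<subseteq> insert up_step down_steps" "length p = n"
      by (auto simp: positive_partial_gdaps_def partial_gdap_def gdap_def dest: set_mono_prefix)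
    moreover have "\<forall>v\<in>set p. - int n \<le> snd v" using bound[OF p] by blast
    ultimately show "p \<in> {p. set p \<subseteq> {1} \<times> {- int n..1} \<and> length p = n}"
      by (fastforce simp: up_step_def down_steps_def down_step_def)
  qed
  then show ?thesis
    by (rule finite_subset) (intro finite_lists_length_eq finite_cartesian_product; simp)
qed

definition positive_partial_gdap_gf :: "real fps" where
  "positive_partial_gdap_gf = Abs_fps (\<lambda>n. of_nat (card (positive_partial_gdaps n)))"

definition fps_sqrt :: "real fps \<Rightarrow> real fps" where
  "fps_sqrt f = fps_radical root 2 f"

lemma fps_sqrt_unique:
  assumes "f $ 0 = 1"
  shows "s ^ 2 = f \<and> s $ 0 = 1 \<longleftrightarrow> s = fps_sqrt f"
proof -
  have "fps_sqrt f ^ Suc 1 = f"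
    unfolding fps_sqrt_def using power_radical[of f root 1] assms by (simp add: numeral_2_eq_2)
  moreover have "fps_sqrt f $ 0 = 1"
    using assms by (simp add: fps_sqrt_def)
  moreover have "s = fps_sqrt f" if "s ^ 2 = f" "s $ 0 = 1"
    using radical_unique[of root 1 f s] that assms
    by (simp add: fps_sqrt_def numeral_2_eq_2)
  ultimately show ?thesis by (auto simp: numeral_2_eq_2)
qed

end

theory Submission
  imports Defs
begin

text \<open>
  Let \<open>A\<^sub>h\<close> be the generating function of the words of admissible steps ending at height
  at least \<open>h\<close>. Every such word is a partial GDAP, so \<open>A\<^sub>1\<close> is wanted. A word of
  length at least 2 starts with \<open>U\<close> or with \<open>D\<^sub>k U\<close>, and for a prescribed final height
  \<open>k\<close> is determined by the rest of the word, hence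
  \<open>A\<^sub>h - A\<^sub>h\<^sub>+\<^sub>1 = x (A\<^sub>h\<^sub>-\<^sub>1 - A\<^sub>h) + x\<^sup>2 A\<^sub>h\<close> up to initial terms.
  As \<open>A\<^sub>h\<close> has order at least \<open>h\<close>, it is governed for positive \<open>h\<close> by the root \<open>B\<close> of
  \<open>B\<^sup>2 - (1 + x - x\<^sup>2) B + x = 0\<close> without constant term, and \<open>A\<^sub>1 = B A\<^sub>0\<close>.
  The recurrence is invariant under \<open>h \<mapsto> -2 - h\<close> with a shift of the length by \<open>h + 1\<close>,
  which gives \<open>A\<^sub>0 = 1 + x A\<^sub>-\<^sub>2\<close> and closes the linear system at the heights \<open>-1\<close>
  and \<open>0\<close>.
\<close>

section \<open>Partial GDAP as words\<close>

definition height :: "(int \<times> int) list \<Rightarrow> int" where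
  "height p = snd (endpoint p)"

text \<open>The closing condition of \<open>gdap\<close> is dropped, and \<open>successively\<close>
  replaces indices so that words can be taken apart at the front and concatenated.\<close>

definition gdap_word :: "(int \<times> int) list \<Rightarrow> bool" where
  "gdap_word p \<longleftrightarrow> set p \<subseteq> insert up_step down_steps \<and>
     successively (\<lambda>s t. \<not> (s \<in> down_steps \<and> t \<in> down_steps)) p"

lemma height_simps [simp]:
  "height [] = 0"
  "height (s # p) = snd s + height p"
  "height (p @ q) = height p + height q"
  by (simp_all add: height_def endpoint_def)

lemma snd_steps [simp]: "snd up_step = 1" "snd (down_step k) = - int k"
  by (simp_all add: up_step_def down_step_def)

lemma up_step_notin_down_steps [simp]: "up_step \<notin> down_steps"
  by (auto simp: up_step_def down_steps_def down_step_def)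

lemma down_step_in_down_steps [simp]: "down_step k \<in> down_steps \<longleftrightarrow> k \<ge> 1"
  by (auto simp: down_steps_def down_step_def)

lemma down_step_neq_up_step [simp]: "down_step k \<noteq> up_step" "up_step \<noteq> down_step k"
  by (auto simp: up_step_def down_step_def)

lemma gdap_word_Nil [simp]: "gdap_word []"
  by (simp add: gdap_word_def)

lemma gdap_word_up [simp]: "gdap_word (up_step # p) \<longleftrightarrow> gdap_word p"
  by (auto simp: gdap_word_def successively_Cons)

lemma gdap_word_down_single [simp]: "gdap_word [down_step k] \<longleftrightarrow> k \<ge> 1"
  by (auto simp: gdap_word_def)

lemma gdap_word_down_up [simp]:
  "gdap_word (down_step k # up_step # p) \<longleftrightarrow> k \<ge> 1 \<and> gdap_word p"
  by (auto simp: gdap_word_def successively_Cons)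

lemma gdap_word_cases [consumes 1, case_names Nil up down down_up]:
  assumes "gdap_word p"
  obtains "p = []"
  | q where "p = up_step # q" "gdap_word q"
  | k where "p = [down_step k]" "k \<ge> 1"
  | k q where "p = down_step k # up_step # q" "k \<ge> 1" "gdap_word q"
proof (cases p)
  case (Cons s q)
  show ?thesis
  proof (cases "s = up_step")
    case True
    with assms Cons that(2) show ?thesis by simp
  next
    case False
    with assms Cons obtain k where s: "s = down_step k" "k \<ge> 1"
      by (auto simp: gdap_word_def down_steps_def)
    show ?thesis
    proof (cases q)
      case Nil
      with Cons s that(3) show ?thesis by simp
    next
      case (Cons t r)
      then have "t = up_step"
        using assms s \<open>p = s # q\<close> by (auto simp: gdap_word_def)
      with Cons s assms \<open>p = s # q\<close> that(4) show ?thesis by simp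
    qed
  qed
qed (use that in simp)

lemma successively_conv_nth:
  "successively P xs \<longleftrightarrow> (\<forall>i. Suc i < length xs \<longrightarrow> P (xs ! i) (xs ! Suc i))"
proof (induction P xs rule: successively.induct)
  case (3 P x y xs)
  show ?case
    unfolding successively.simps "3.IH" by (auto simp: nth_Cons all_conj_distrib split: nat.splits)
qed auto

lemma gdap_iff: "gdap p \<longleftrightarrow> gdap_word p \<and> height p = 0"
  by (auto simp: gdap_def gdap_word_def height_def successively_conv_nth)

lemma gdap_word_replicate_up: "gdap_word p \<Longrightarrow> gdap_word (p @ replicate k up_step)"
  by (induction k)
     (auto simp: gdap_word_def successively_append_iff replicate_append_same[symmetric]
       simp flip: append_assoc simp del: append_assoc replicate_append_same)

lemma height_replicate_up [simp]: "height (replicate k up_step) = int k"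
  by (induction k) auto

lemma partial_gdap_iff: "partial_gdap p \<longleftrightarrow> gdap_word p"
proof
  assume "partial_gdap p"
  then show "gdap_word p"
    by (auto simp: partial_gdap_def gdap_iff prefix_def gdap_word_def successively_append_iff)
next
  assume p: "gdap_word p"
  show "partial_gdap p"
  proof (cases "height p \<ge> 0")
    case True
    \<comment> \<open>The inserted up-step separates a possible final down-step of \<open>p\<close>
      from the new one and gives the latter size at least 1 even at height 0.\<close>
    define q where "q = p @ [up_step, down_step (nat (height p + 1))]"
    have "gdap_word q"
      using p True unfolding q_def gdap_word_def by (auto simp: successively_append_iff)
    moreover have "height q = 0" "prefix p q"
      using True by (simp_all add: q_def)
    ultimately show ?thesis
      by (auto simp: partial_gdap_def gdap_iff)
  next
    case False
    have "gdap_word (p @ replicate (nat (- height p)) up_step)"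
      using p by (rule gdap_word_replicate_up)
    moreover have "height (p @ replicate (nat (- height p)) up_step) = 0"
      using False by simp
    ultimately show ?thesis
      unfolding partial_gdap_def gdap_iff by (metis prefixI)
  qed
qed

section \<open>Counting words by length and final height\<close>

definition words_at :: "nat \<Rightarrow> int \<Rightarrow> (int \<times> int) list set" where
  "words_at n h = {p. gdap_word p \<and> length p = n \<and> height p = h}"

definition words_above :: "nat \<Rightarrow> int \<Rightarrow> (int \<times> int) list set" where
  "words_above n h = {p. gdap_word p \<and> length p = n \<and> height p \<ge> h}"

lemma height_le_length: "gdap_word p \<Longrightarrow> height p \<le> int (length p)"
proof (induction p rule: length_induct)
  case (1 p)
  from \<open>gdap_word p\<close> show ?case
  proof (cases rule: gdap_word_cases)
    case (up q)
    with 1 show ?thesis by fastforce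
  next
    case (down_up k q)
    with 1 have "height q \<le> int (length q)" by auto
    with down_up show ?thesis by simp
  qed auto
qed

lemma words_above_empty: "int n < h \<Longrightarrow> words_above n h = {}"
  using height_le_length by (fastforce simp: words_above_def)

lemma words_above_split: "words_above n h = words_at n h \<union> words_above n (h + 1)"
  by (auto simp: words_above_def words_at_def)

lemma words_at_0: "words_at 0 h = (if h = 0 then {[]} else {})"
  by (auto simp: words_at_def)

lemma words_at_1:
  "words_at 1 h =
    (if h = 1 then {[up_step]} else if h \<le> -1 then {[down_step (nat (- h))]} else {})"
  (is "_ = ?R")
proof
  show "words_at 1 h \<subseteq> ?R"
  proof
    fix p assume "p \<in> words_at 1 h"
    then have p: "gdap_word p" "length p = 1" "height p = h"
      by (auto simp: words_at_def)
    from p(1) show "p \<in> ?R"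
      by (cases rule: gdap_word_cases) (use p in auto)
  qed
qed (auto simp: words_at_def)

text \<open>In the second case h = -k + 1 + \<open>height p\<close> forces the size k, and k \<ge> 1
  holds exactly when \<open>height p\<close> is at least \<open>h\<close>; this is how
  \<open>words_above\<close> enters.\<close>

lemma words_at_Suc_Suc:
  "words_at (Suc (Suc n)) h =
    (#) up_step ` words_at (Suc n) (h - 1) \<union>
    (\<lambda>p. down_step (nat (height p - h + 1)) # up_step # p) ` words_above n h"
  (is "_ = ?U \<union> ?D")
proof
  show "words_at (Suc (Suc n)) h \<subseteq> ?U \<union> ?D"
  proof
    fix p assume "p \<in> words_at (Suc (Suc n)) h"
    then have p: "gdap_word p" "length p = Suc (Suc n)" "height p = h"
      by (auto simp: words_at_def)
    from p(1) show "p \<in> ?U \<union> ?D"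
    proof (cases rule: gdap_word_cases)
      case (up q)
      then have "q \<in> words_at (Suc n) (h - 1)"
        using p by (auto simp: words_at_def)
      then show ?thesis using up by blast
    next
      case (down_up k q)
      then have "q \<in> words_above n h" "k = nat (height q - h + 1)"
        using p by (auto simp: words_above_def)
      then show ?thesis using down_up by blast
    qed (use p in auto)
  qed
qed (auto simp: words_at_def words_above_def)

text \<open>Final heights are unbounded below but at most the length, so only finitely many of them
  are at least \<open>h\<close>.\<close>

lemma finite_words_above_if_words_at:
  assumes "\<And>h. finite (words_at n h)"
  shows "finite (words_above n h)"
proof -
  have "words_above n h \<subseteq> (\<Union>j\<in>{h..int n}. words_at n j)"
    using height_le_length by (fastforce simp: words_above_def words_at_def)
  then show ?thesis
    by (rule finite_subset) (use assms in auto)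
qed

lemma finite_words_at: "finite (words_at n h)"
proof (induction n arbitrary: h rule: less_induct)
  case (less n)
  consider "n = 0" | "n = 1" | m where "n = Suc (Suc m)"
    by (metis One_nat_def not0_implies_Suc)
  then show ?case
  proof cases
    case 3
    then show ?thesis
      using less by (auto simp: words_at_Suc_Suc intro!: finite_imageI finite_words_above_if_words_at)
  qed (simp_all add: words_at_0 words_at_1 del: One_nat_def)
qed

lemma finite_words_above: "finite (words_above n h)"
  by (rule finite_words_above_if_words_at) (rule finite_words_at)

section \<open>Counts of words above a height: recurrence and reflection\<close>

definition num_above :: "nat \<Rightarrow> int \<Rightarrow> int" where
  "num_above n h = int (card (words_above n h))"

lemma card_words_at: "int (card (words_at n h)) = num_above n h - num_above n (h + 1)"
proof -
  have "card (words_above n h) = card (words_at n h) + card (words_above n (h + 1))"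
    unfolding words_above_split[of n h]
    by (rule card_Un_disjoint)
       (auto simp: finite_words_at finite_words_above, auto simp: words_at_def words_above_def)
  then show ?thesis by (simp add: num_above_def)
qed

lemma num_above_eq_0: "int n < h \<Longrightarrow> num_above n h = 0"
  by (simp add: num_above_def words_above_empty)

lemma num_above_0: "num_above 0 h = (if h \<le> 0 then 1 else 0)"
proof -
  have "words_above 0 h = (if h \<le> 0 then {[]} else {})"
    by (auto simp: words_above_def)
  then show ?thesis by (simp add: num_above_def)
qed

lemma num_above_1_diff:
  "num_above 1 h - num_above 1 (h + 1) = (if h = 1 \<or> h \<le> -1 then 1 else 0)"
  by (simp add: card_words_at[symmetric] words_at_1 del: One_nat_def)

lemma num_above_rec:
  "num_above (Suc (Suc n)) h - num_above (Suc (Suc n)) (h + 1) =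
     num_above (Suc n) (h - 1) - num_above (Suc n) h + num_above n h"
proof -
  have "card (words_at (Suc (Suc n)) h) = card (words_at (Suc n) (h - 1)) + card (words_above n h)"
    unfolding words_at_Suc_Suc
    by (subst card_Un_disjoint)
       (auto simp: finite_words_at finite_words_above card_image inj_on_def)
  then show ?thesis
    using card_words_at[of "Suc (Suc n)" h] card_words_at[of "Suc n" "h - 1"]
    by (simp add: num_above_def)
qed

text \<open>These values feed the base cases of the reflection. A down-step in place of an up-step
  costs at least 2 in height, so the first two count only the all-up word; the third adds the m + 2
  positions of a single \<open>down_step 1\<close>.\<close>

lemma num_above_diag:
  "num_above m (int m) = 1"
  "num_above (Suc m) (int m) = 1"
  "num_above (Suc (Suc m)) (int m) = int m + 3"
proof -
  have diag: "num_above m (int m) = 1" for m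
  proof (induction m)
    case 0
    show ?case by (simp add: num_above_0)
  next
    case (Suc m)
    show ?case
    proof (cases m)
      case 0
      then show ?thesis
        using num_above_1_diff[of 1] num_above_eq_0[of 1 2] by simp
    next
      case (Suc k)
      then show ?thesis
        using num_above_rec[of k "int (Suc m)"] Suc.IH
        by (simp add: num_above_eq_0)
    qed
  qed
  have sub: "num_above (Suc m) (int m) = 1" for m
  proof (induction m)
    case 0
    show ?case
      using num_above_1_diff[of 0] diag[of 1] by simp
  next
    case (Suc m)
    show ?case
      using num_above_rec[of m "int (Suc m)"] Suc.IH diag[of "Suc m"] diag[of "Suc (Suc m)"]
      by (simp add: num_above_eq_0 add_ac)
  qed
  show "num_above m (int m) = 1" "num_above (Suc m) (int m) = 1"
    by (rule diag, rule sub)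
  show "num_above (Suc (Suc m)) (int m) = int m + 3"
  proof (induction m)
    case 0
    have "num_above (Suc 0) (-1) = 2"
      using num_above_1_diff[of "-1"] sub[of 0] by simp
    then show ?case
      using num_above_rec[of 0 0] sub[of 0] sub[of 1] by (simp add: num_above_0)
  next
    case (Suc m)
    show ?case
      using num_above_rec[of "Suc m" "int (Suc m)"] Suc.IH diag[of "Suc m"]
        sub[of "Suc m"] sub[of "Suc (Suc m)"]
      by (simp add: add_ac)
  qed
qed

lemma num_above_1_neg: "num_above 1 (- 1 - int m) = int m + 2"
proof (induction m)
  case 0
  show ?case
    using num_above_1_diff[of "-1"] num_above_diag(2)[of 0] by simp
next
  case (Suc m)
  show ?case
    using num_above_1_diff[of "- 2 - int m"] Suc by simp
qed

text \<open>The reflection \<open>h \<mapsto> -2 - h\<close> with \<open>m = h + 1\<close>: both sides satisfy the recurrence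
  \<open>num_above_rec\<close>, whose terms are permuted by it.\<close>

lemma num_above_reflect: "num_above n (- 1 - int m) = num_above (n + m) (int m - 1)"
proof (induction n arbitrary: m rule: less_induct)
  case (less n)
  consider "n = 0" | "n = 1" | k where "n = Suc (Suc k)"
    by (metis One_nat_def not0_implies_Suc)
  then show ?case
  proof cases
    case 1
    then show ?thesis
      using num_above_diag(2)[of "m - 1"] by (cases m) (simp_all add: num_above_0)
  next
    case 2
    then show ?thesis
      using num_above_diag(3)[of "m - 1"] num_above_1_neg[of m] by (cases m) simp_all
  next
    case 3
    show ?thesis
    \<comment> \<open>The recurrence controls only differences between neighbouring heights, so
      \<open>m\<close> is built up from 0, where both sides are the same term. Reflection exchanges
      the term at height h + 1 of the longest length with the one at h - 1 of the next shorter
      length.\<close>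
    proof (induction m)
      case (Suc m)
      have "num_above (Suc k) (- int m - 3) = num_above (Suc k + (m + 2)) (int m + 1)"
        "num_above (Suc k) (- int m - 2) = num_above (Suc k + (m + 1)) (int m)"
        "num_above k (- int m - 2) = num_above (k + (m + 1)) (int m)"
        using less.IH[of "Suc k" "m + 2"] less.IH[of "Suc k" "m + 1"] less.IH[of k "m + 1"] 3
        by (simp_all add: algebra_simps)
      then show ?case
        using num_above_rec[of k "- int m - 2"] num_above_rec[of "k + m + 1" "int m"] Suc 3
        by (simp add: add_ac)
    qed simp
  qed
qed

section \<open>Generating functions\<close>

definition gf_above :: "int \<Rightarrow> real fps" where
  "gf_above h = Abs_fps (\<lambda>n. of_int (num_above n h))"

lemma positive_partial_gdap_gf_eq: "positive_partial_gdap_gf = gf_above 1"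
proof -
  have "positive_partial_gdaps n = words_above n 1" for n
    by (auto simp: positive_partial_gdaps_def words_above_def partial_gdap_iff height_def)
  then show ?thesis
    by (simp add: positive_partial_gdap_gf_def gf_above_def num_above_def)
qed

text \<open>The last two summands account for the empty word and the single down-steps; the word
  consisting of one up-step is already counted as an up-step before the empty word.\<close>

lemma gf_above_rec:
  "gf_above h - gf_above (h + 1) =
     fps_X * (gf_above (h - 1) - gf_above h) + fps_X ^ 2 * gf_above h +
     (if h = 0 then 1 else 0) + (if h \<le> -1 then fps_X else 0)"
proof (rule fps_ext)
  fix n
  consider "n = 0" | "n = 1" | k where "n = Suc (Suc k)"
    by (metis One_nat_def not0_implies_Suc)
  then show "(gf_above h - gf_above (h + 1)) $ n =
    (fps_X * (gf_above (h - 1) - gf_above h) + fps_X ^ 2 * gf_above h +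
     (if h = 0 then 1 else 0) + (if h \<le> -1 then fps_X else 0)) $ n"
  proof cases
    case 1
    then show ?thesis
      by (simp add: gf_above_def num_above_0 fps_X_power_mult_nth)
  next
    case 2
    have "real_of_int (num_above 1 h - num_above 1 (h + 1)) = (if h = 1 \<or> h \<le> -1 then 1 else 0)"
      by (simp only: num_above_1_diff) simp
    with 2 show ?thesis
      by (auto simp: gf_above_def num_above_0 fps_X_power_mult_nth split: if_splits)
  next
    case 3
    have "real_of_int (num_above (Suc (Suc k)) h - num_above (Suc (Suc k)) (h + 1)) =
      real_of_int (num_above (Suc k) (h - 1) - num_above (Suc k) h + num_above k h)"
      by (simp only: num_above_rec)
    with 3 show ?thesis
      by (auto simp: gf_above_def fps_X_power_mult_nth)
  qed
qed

lemma gf_above_0_eq: "gf_above 0 = 1 + fps_X * gf_above (-2)"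
proof (rule fps_ext)
  fix n
  show "gf_above 0 $ n = (1 + fps_X * gf_above (-2)) $ n"
    using num_above_reflect[of "n - 1" 1] by (cases n) (simp_all add: gf_above_def num_above_0)
qed

text \<open>Multiplying by powers of \<open>u\<close> does not move the lowest nonzero coefficient
  of \<open>f\<close>, so it cannot be pushed to arbitrarily high order.\<close>

lemma fps_eq_0_if_unit_power_mult:
  fixes f u :: "'a :: idom fps"
  assumes u: "u $ 0 \<noteq> 0" and low: "\<And>k i. i < k \<Longrightarrow> (u ^ k * f) $ i = 0"
  shows "f = 0"
proof (rule ccontr)
  assume f: "f \<noteq> 0"
  define d where "d = subdegree f"
  have "subdegree (u ^ Suc d) = 0" "(u ^ Suc d) $ 0 \<noteq> 0"
    using u by (simp_all add: fps_nth_power_0)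
  then have "(u ^ Suc d * f) $ d = (u ^ Suc d) $ 0 * f $ d"
    unfolding d_def by (simp only: nth_subdegree_mult_right)
  with low[of d "Suc d"] f \<open>(u ^ Suc d) $ 0 \<noteq> 0\<close> show False
    by (simp add: d_def)
qed

text \<open>\<open>B\<close> and \<open>C\<close> are the two roots of the characteristic equation of \<open>gf_above_rec\<close>; the
  contribution of the unit \<open>C\<close> would not tend to zero.\<close>

lemma gf_above_1_eq:
  fixes B C :: "real fps"
  assumes sum: "B + C = 1 + fps_X - fps_X ^ 2" and prod: "B * C = fps_X" and B0: "B $ 0 = 0"
  shows "gf_above 1 = B * gf_above 0"
proof -
  \<comment> \<open>\<open>G\<close> measures the deviation from a geometric sequence of ratio
    \<open>B\<close>. Splitting off the root \<open>B\<close> leaves a first-order recurrence of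
    ratio \<open>C\<close>.\<close>
  define G where "G k = gf_above (int k + 1) - B * gf_above (int k)" for k
  have step: "G (Suc k) = C * G k" for k
  proof -
    have "gf_above (int k + 2) = (B + C) * gf_above (int k + 1) - B * C * gf_above (int k)"
      using gf_above_rec[of "int k + 1"] unfolding sum prod by (simp add: algebra_simps)
    then show ?thesis by (simp add: G_def algebra_simps)
  qed
  have pow: "G k = C ^ k * G 0" for k
    by (induction k) (simp_all add: step)
  have "C $ 0 = 1"
    using arg_cong[OF sum, of "\<lambda>f. f $ 0"] B0 by simp
  moreover have "(C ^ k * G 0) $ i = 0" if "i < k" for k i
  proof -
    have "gf_above (int k + 1) $ i = 0" "\<And>j. j \<le> i \<Longrightarrow> gf_above (int k) $ j = 0"
      using that by (simp_all add: gf_above_def num_above_eq_0)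
    then have "G k $ i = 0"
      by (simp add: G_def fps_mult_nth)
    then show ?thesis by (simp flip: pow)
  qed
  ultimately have "G 0 = 0"
    by (intro fps_eq_0_if_unit_power_mult[of C]) auto
  then show ?thesis by (simp add: G_def)
qed

lemma gf_above_1_closed_form:
  fixes S :: "real fps"
  assumes S2: "S ^ 2 = fps_X ^ 4 - 2 * fps_X ^ 3 - fps_X ^ 2 - 2 * fps_X + 1" and S0: "S $ 0 = 1"
  shows "gf_above 1 * (4 * fps_X * S) = (fps_X ^ 2 - fps_X - 1 + S) ^ 2"
proof -
  \<comment> \<open>By the quadratic formula: the square of \<open>S\<close> is the discriminant (1
    + x - x^2)^2 - 4x. The minus sign gives the root without constant term.\<close>
  define B C :: "real fps" where
    "B = fps_const (1/2) * (1 + fps_X - fps_X ^ 2 - S)" and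
    "C = fps_const (1/2) * (1 + fps_X - fps_X ^ 2 + S)"
  have two: "2 * fps_const (1/2 :: real) = 1"
    by (simp add: numeral_fps_const)
  have B2: "2 * B = 1 + fps_X - fps_X ^ 2 - S" and C2: "2 * C = 1 + fps_X - fps_X ^ 2 + S"
    unfolding B_def C_def mult.assoc[symmetric] two by simp_all
  have sum: "B + C = 1 + fps_X - fps_X ^ 2"
  proof -
    have "2 * (B + C) = 2 * (1 + fps_X - fps_X ^ 2)"
      unfolding distrib_left[of 2 B C] B2 C2 by simp
    then show ?thesis by (subst (asm) mult_cancel_left) simp
  qed
  have prod: "B * C = fps_X"
  proof -
    have "4 * (B * C) = (2 * B) * (2 * C)" by simp
    also have "\<dots> = (1 + fps_X - fps_X ^ 2) ^ 2 - S ^ 2"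
      unfolding B2 C2 by (simp add: algebra_simps power2_eq_square)
    also have "\<dots> = 4 * fps_X"
      unfolding S2 by algebra
    finally show ?thesis by simp
  qed
  have S: "S = C - B"
  proof -
    have "2 * S = 2 * C - 2 * B" unfolding B2 C2 by simp
    then have "2 * S = 2 * (C - B)" by (simp only: right_diff_distrib)
    then show ?thesis by (subst (asm) mult_cancel_left) simp
  qed
  define A0 A1 M1 M2 where
    "A0 = gf_above 0" "A1 = gf_above 1" "M1 = gf_above (-1)" "M2 = gf_above (-2)"
  note A_defs = this
  have A1: "A1 = B * A0"
    unfolding A_defs using sum prod by (rule gf_above_1_eq) (simp add: B_def S0)
  have "A0 - A1 = fps_X * (M1 - A0) + fps_X ^ 2 * A0 + 1"
    using gf_above_rec[of 0] by (simp add: A_defs)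
  then have M1: "(B + C) * A0 = 1 + fps_X * M1 + B * A0"
    unfolding A1 sum by algebra
  have "M1 - A0 = fps_X * (M2 - M1) + fps_X ^ 2 * M1 + fps_X"
    using gf_above_rec[of "-1"] by (simp add: A_defs)
  moreover have "A0 = 1 + fps_X * M2"
    unfolding A_defs by (rule gf_above_0_eq)
  ultimately have A0: "(B + C) * M1 = 2 * A0 - 1 + fps_X"
    unfolding sum by algebra
  \<comment> \<open>\<open>M1\<close> is eliminated from the equations at heights 0 and -1. By
    \<open>sum\<close> the right-hand side is 1, and by \<open>prod\<close> the factor of
    \<open>A0\<close> becomes C (C - B).\<close>
  have "A0 * ((B + C) * C - 2 * fps_X) = (B + C) - fps_X + fps_X ^ 2"
    using M1 A0 by algebra
  then have "A0 * ((B + C) * C - 2 * (B * C)) = 1"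
    unfolding prod by (simp add: sum)
  then have "A0 * S * C = 1"
    unfolding S by algebra
  then have "A1 * (fps_X * S) = B ^ 2"
    unfolding A1 prod[symmetric] by algebra
  then have "A1 * (4 * fps_X * S) = (2 * B) ^ 2"
    by algebra
  \<comment> \<open>The two bases differ only in sign.\<close>
  also have "\<dots> = (fps_X ^ 2 - fps_X - 1 + S) ^ 2"
    unfolding B2 by algebra
  finally show ?thesis by (simp add: A_defs)
qed

theorem theorem2:
  fixes S :: "real fps"
  defines "S \<equiv> fps_sqrt (fps_X ^ 4 - 2 * fps_X ^ 3 - fps_X ^ 2 - 2 * fps_X + 1)"
  shows "fps_to_fls positive_partial_gdap_gf =
    (fps_to_fls (fps_X ^ 2 - fps_X - 1 + S)) ^ 2 / (4 * fls_X * fps_to_fls S)"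
proof -
  have S: "S ^ 2 = fps_X ^ 4 - 2 * fps_X ^ 3 - fps_X ^ 2 - 2 * fps_X + 1" "S $ 0 = 1"
    using fps_sqrt_unique[of "fps_X ^ 4 - 2 * fps_X ^ 3 - fps_X ^ 2 - 2 * fps_X + 1" S]
    unfolding S_def by (simp_all add: fps_X_power_nth)
  then have "S \<noteq> 0" by auto
  \<comment> \<open>The denominator has zero constant term, so the division takes place in the field
    of Laurent series.\<close>
  have "fps_to_fls (gf_above 1 * (4 * fps_X * S)) = fps_to_fls ((fps_X ^ 2 - fps_X - 1 + S) ^ 2)"
    using gf_above_1_closed_form[OF S] by (rule arg_cong)
  then have "fps_to_fls (gf_above 1) * (4 * fls_X * fps_to_fls S) =
      fps_to_fls (fps_X ^ 2 - fps_X - 1 + S) ^ 2"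
    by (simp only: fls_times_fps_to_fls fps_to_fls_power fps_to_fls_numeral fps_X_to_fls)
  moreover have "4 * fls_X * fps_to_fls S \<noteq> 0"
    using \<open>S \<noteq> 0\<close> by simp
  ultimately show ?thesis
    unfolding positive_partial_gdap_gf_eq by (simp only: nonzero_eq_divide_eq not_False_eq_True)
qed

end
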